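(* Let $m,n$ be relatively prime positive integers. Then $$S\left(\frac{n}{m}\right)=\frac{\ln(2\pi)-\gamma}{2}-\frac{1}{2m}-\frac12\ln\frac{m}{n}+\frac{\pi}{2n}\sum_{k=1}^{n-1}\left(\frac n2-k\right)\cot\frac{mk\pi}{n}+\frac{n\pi}{2m^2}\sum_{j=1}^{m-1}\left(\frac m2-j\right)\cot\frac{nj\pi}{m}.$$
   Context: Let $\psi(u)=\frac{d\ln\Gamma(u)}{du}$ be the digamma function and let $\gamma$ be the Euler-Mascheroni constant. For real $a>0$ define $$S(a)=\sum_{l=1}^\infty\left[\ln\frac{l}{a}-\frac{a}{2l}-\psi\left(\frac{l}{a}\right)\right].$$ Empty sums are $0$. *)

theory Defs
  imports "HOL-Analysis.Analysis"
begin

definition S_summand :: "real \<Rightarrow> nat \<Rightarrow> real" where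
  "S_summand a l = ln (real l / a) - a / (2 * real l) - Digamma (real l / a)"

(* The series starts at l = 1, hence the shift by Suc. *)
definition S :: "real \<Rightarrow> real" where
  "S a = (\<Sum>l. S_summand a (Suc l))"

end

theory Submission
  imports Defs "HOL-Real_Asymp.Real_Asymp"
begin

text \<open>
  Sum the series over blocks of length n. By the multiplication theorem for the digamma function,
  each value at (q n + r) m / n becomes an average of its values at q + y with y = r/n + j/m,
  and summing these over q telescopes, because (y - 1) \<psi>(y) - y is an antidifference of \<psi>.
  What survives in the limit, besides Stirling and Euler-Mascheroni constants, is the sum of
  (y - 1) \<psi>(y) over the grid of all y, where 1 \<le> r \<le> n and 0 \<le> j < m. The reflection
  y \<mapsto> 2 - y preserves the interior of the grid and turns this sum into one of (y - 1) cot (\<pi> y);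
  since y is the sum of its two coordinates, summing the cotangent over the other coordinate
  leaves the two single cotangent sums.
\<close>

section \<open>Multiplication and reflection formulas\<close>

lemma sum_lessThan_mult_split:
  fixes f :: "nat \<Rightarrow> 'a::comm_monoid_add"
  shows "(\<Sum>k<m * N. f k) = (\<Sum>i<N. \<Sum>j<m. f (m * i + j))"
proof -
  have "(\<Sum>i<N. \<Sum>j<m. f (m * i + j)) = (\<Sum>i<N. \<Sum>k=i*m..<i*m+m. f k)"
  proof (rule sum.cong[OF refl])
    fix i
    show "(\<Sum>j<m. f (m * i + j)) = (\<Sum>k=i*m..<i*m+m. f k)"
      using sum.shift_bounds_nat_ivl[of f 0 "i*m" m]
      by (simp add: atLeast0LessThan add.commute mult.commute)
  qed
  also have "\<dots> = (\<Sum>k<m * N. f k)"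
    by (simp add: sum.nat_group mult.commute)
  finally show ?thesis ..
qed

text \<open>Along M = m N the terms of the limit formula \<open>Digamma_LIMSEQ\<close> for m z split
  by residue mod m into m blocks of N terms, each of which is the limit formula for one z + j/m.
  Writing ln (m N) = ln m + ln N leaves the extra ln m. Only arguments 0 are excluded, since that
  limit formula covers every nonzero point.\<close>

lemma Digamma_multiplication:
  fixes z :: real
  assumes m: "m > 0" and nz: "\<And>j. j < m \<Longrightarrow> z + real j / real m \<noteq> 0"
  shows "Digamma (real m * z) = ln (real m) + (\<Sum>j<m. Digamma (z + real j / real m)) / real m"
proof (rule LIMSEQ_unique)
  have z: "z \<noteq> 0" using nz[of 0] m by simp
  have "(\<lambda>M. ln (real M) - (\<Sum>k<M. inverse (real m * z + real k))) \<longlonglongrightarrow> Digamma (real m * z)"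
    using Digamma_LIMSEQ[of "real m * z"] z m by simp
  moreover have "filterlim (\<lambda>N. m * N) sequentially sequentially"
    by (rule filterlim_subseq) (simp add: strict_mono_def m)
  ultimately show "(\<lambda>N. ln (real (m * N)) - (\<Sum>k<m * N. inverse (real m * z + real k)))
      \<longlonglongrightarrow> Digamma (real m * z)"
    by (rule filterlim_compose)
next
  let ?D = "\<lambda>N j. ln (real N) - (\<Sum>i<N. inverse (z + real j / real m + real i))"
  have "(\<lambda>N. ?D N j) \<longlonglongrightarrow> Digamma (z + real j / real m)" if "j < m" for j
    using Digamma_LIMSEQ[OF nz[OF that]] by simp
  then have "(\<lambda>N. ln (real m) + (\<Sum>j<m. ?D N j) / real m)
      \<longlonglongrightarrow> ln (real m) + (\<Sum>j<m. Digamma (z + real j / real m)) / real m"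
    by (intro tendsto_intros) (use m in auto)
  moreover have "eventually (\<lambda>N. ln (real m) + (\<Sum>j<m. ?D N j) / real m =
      ln (real (m * N)) - (\<Sum>k<m * N. inverse (real m * z + real k))) sequentially"
    using eventually_gt_at_top[of 0]
  proof eventually_elim
    case (elim N)
    have "inverse (real m * z + real (m * i + j)) = inverse (z + real j / real m + real i) / real m"
      for i j
    proof -
      have "real m * z + real (m * i + j) = real m * (z + real j / real m + real i)"
        using m by (simp add: field_simps)
      then show ?thesis by (simp add: field_simps)
    qed
    then have "(\<Sum>k<m * N. inverse (real m * z + real k)) =
        (\<Sum>i<N. \<Sum>j<m. inverse (z + real j / real m + real i)) / real m"
      by (simp add: sum_lessThan_mult_split sum_divide_distrib)
    also have "\<dots> = (\<Sum>j<m. \<Sum>i<N. inverse (z + real j / real m + real i)) / real m"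
      by (subst sum.swap) simp
    finally show ?case
      using m elim by (simp add: sum_subtractf ln_mult field_simps)
  qed
  ultimately show "(\<lambda>N. ln (real (m * N)) - (\<Sum>k<m * N. inverse (real m * z + real k)))
      \<longlonglongrightarrow> ln (real m) + (\<Sum>j<m. Digamma (z + real j / real m)) / real m"
    by (rule Lim_transform_eventually)
qed

text \<open>This is the logarithmic derivative of Euler's reflection formula, taken in the product
  form Gamma(t) Gamma(1 - t) sin(pi t) = pi so that no quotient has to be differentiated.\<close>

lemma Digamma_reflection_real:
  fixes x :: real
  assumes x: "x \<notin> \<int>"
  shows "Digamma (1 - x) - Digamma x = pi * cot (pi * x)"
proof -
  have Gamma_refl: "Gamma t * Gamma (1 - t) * sin (pi * t) = pi" if "t \<notin> \<int>" for t :: real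
  proof -
    have "complex_of_real (Gamma t * Gamma (1 - t)) = complex_of_real (pi / sin (pi * t))"
      using Gamma_reflection_complex[of "complex_of_real t"]
      by (simp flip: Gamma_complex_of_real sin_of_real)
    then have "Gamma t * Gamma (1 - t) = pi / sin (pi * t)"
      by (simp only: of_real_eq_iff)
    moreover have "sin (pi * t) \<noteq> 0"
      using that by (metis mult.commute sin_times_pi_eq_0)
    ultimately show ?thesis by simp
  qed
  have s: "sin (pi * x) \<noteq> 0"
    using x by (metis mult.commute sin_times_pi_eq_0)
  have n1: "x \<notin> \<int>\<^sub>\<le>\<^sub>0" "1 - x \<notin> \<int>\<^sub>\<le>\<^sub>0"
    using x nonpos_Ints_Int Ints_diff[of 1 "1 - x"] by force+
  let ?g = "\<lambda>t. Gamma t * Gamma (1 - t) * sin (pi * t)"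
  have "(?g has_field_derivative
      Gamma x * Gamma (1 - x) *
        ((Digamma x - Digamma (1 - x)) * sin (pi * x) + pi * cos (pi * x))) (at x)"
    by (rule derivative_eq_intros refl n1 | simp add: algebra_simps)+
  \<comment> \<open>The product equals pi only off the integers; their complement is open, so it is
    constant near x.\<close>
  moreover have "(?g has_field_derivative 0) (at x)"
  proof (rule has_field_derivative_transform_within_open)
    show "((\<lambda>t. pi) has_field_derivative 0) (at x)" by simp
    show "open (- (\<int>::real set))" using closed_Ints by (simp add: closed_def Compl_eq)
  qed (use x Gamma_refl in auto)
  ultimately have "Gamma x * Gamma (1 - x) *
        ((Digamma x - Digamma (1 - x)) * sin (pi * x) + pi * cos (pi * x)) = 0"
    by (rule DERIV_unique)
  moreover have "Gamma x \<noteq> 0" "Gamma (1 - x) \<noteq> 0"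
    using n1 by (simp_all add: Gamma_eq_zero_iff)
  ultimately have "(Digamma x - Digamma (1 - x)) * sin (pi * x) + pi * cos (pi * x) = 0"
    by simp
  then show ?thesis
    using s by (simp add: cot_def field_simps)
qed

text \<open>Subtract the multiplication formula at z from the one at 1/m - z. Under j -> m - 1 - j
  the points of the latter become 1 - (z + j/m), the ln m cancels, and reflection turns both sides
  into cotangents.\<close>

lemma sum_cot_equidistant:
  fixes z :: real
  assumes m: "m > 0" and z: "real m * z \<notin> \<int>"
  shows "(\<Sum>j<m. cot (pi * (z + real j / real m))) = real m * cot (pi * (real m * z))"
proof -
  have ni: "z + real j / real m \<notin> \<int>" for j
  proof
    assume "z + real j / real m \<in> \<int>"
    then have "real m * (z + real j / real m) - real j \<in> \<int>" by (intro Ints_diff Ints_mult) auto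
    moreover have "real m * (z + real j / real m) - real j = real m * z"
      using m by (simp add: field_simps)
    ultimately show False using z by simp
  qed
  have eq: "1 / real m - z + real (m - Suc j) / real m = 1 - (z + real j / real m)" if "j < m" for j
    using that m by (simp add: field_simps of_nat_diff)
  have "Digamma (real m * z) = ln (real m) + (\<Sum>j<m. Digamma (z + real j / real m)) / real m"
    using ni by (intro Digamma_multiplication[OF m]) (metis Ints_0)
  moreover have "Digamma (real m * (1 / real m - z)) =
      ln (real m) + (\<Sum>j<m. Digamma (1 / real m - z + real j / real m)) / real m"
  proof (rule Digamma_multiplication[OF m])
    fix j assume "j < m"
    then have "1 / real m - z + real j / real m = 1 - (z + real (m - Suc j) / real m)"
      using m by (simp add: field_simps of_nat_diff)
    moreover have "1 - (z + real (m - Suc j) / real m) \<noteq> 0"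
      using ni[of "m - Suc j"] by (metis Ints_1 right_minus_eq)
    ultimately show "1 / real m - z + real j / real m \<noteq> 0" by metis
  qed
  moreover have "(\<Sum>j<m. Digamma (1 / real m - z + real j / real m)) =
      (\<Sum>j<m. Digamma (1 - (z + real j / real m)))"
    by (subst sum.nat_diff_reindex[symmetric]) (rule sum.cong[OF refl], simp only: eq lessThan_iff)
  moreover have "real m * (1 / real m - z) = 1 - real m * z"
    using m by (simp add: field_simps)
  ultimately have "Digamma (1 - real m * z) - Digamma (real m * z) =
      (\<Sum>j<m. Digamma (1 - (z + real j / real m)) - Digamma (z + real j / real m)) / real m"
    by (simp add: sum_subtractf diff_divide_distrib)
  then have "pi * cot (pi * (real m * z)) = (\<Sum>j<m. pi * cot (pi * (z + real j / real m))) / real m"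
    by (simp only: Digamma_reflection_real[OF z] Digamma_reflection_real[OF ni])
  then show ?thesis
    using m by (simp add: sum_distrib_left[symmetric] field_simps)
qed

section \<open>Asymptotics\<close>

lemma Digamma_plus_of_nat_minus_ln_tendsto_0:
  fixes x :: real
  assumes x: "x > 0"
  shows "(\<lambda>n. Digamma (x + real n) - ln (real n)) \<longlonglongrightarrow> 0"
proof -
  have step: "Digamma (x + real n) = Digamma x + (\<Sum>k<n. inverse (x + real k))" for n
  proof (induction n)
    case (Suc n)
    have "Digamma (x + real (Suc n)) = Digamma ((x + real n) + 1)" by (simp add: add_ac)
    also have "\<dots> = Digamma (x + real n) + 1 / (x + real n)"
      using x by (intro Digamma_plus1) (use of_nat_0_le_iff[of n] in linarith)
    finally show ?case using Suc by (simp add: inverse_eq_divide)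
  qed simp
  have "(\<lambda>n. Digamma x - (ln (real n) - (\<Sum>k<n. inverse (x + real k)))) \<longlonglongrightarrow> Digamma x - Digamma x"
    using Digamma_LIMSEQ[of x] x by (intro tendsto_intros) auto
  then show ?thesis by (simp add: step algebra_simps)
qed

lemma Digamma_real_asymptotic_bounds:
  fixes x :: real
  assumes x: "x > 0"
  shows "Digamma x \<le> ln x - 1 / (2 * x)"
    and "ln x - 1 / (2 * x) - 1 / (8 * x\<^sup>2) \<le> Digamma x"
proof -
  \<comment> \<open>Both bounds hold because, under unit steps, g increases to 0 and h decreases to 0.\<close>
  define g where "g = (\<lambda>x::real. Digamma x - ln x + 1 / (2 * x))"
  define h where "h = (\<lambda>x::real. g x + 1 / (8 * x\<^sup>2))"
  \<comment> \<open>The increment of g is the error of the trapezoidal rule for the integral of 1/s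
    over [t, t + 1]; by convexity it is nonnegative.\<close>
  have gstep: "g (t + 1) - g t = (1 / t + 1 / (t + 1)) / 2 - (ln (t + 1) - ln t)" if "t > 0" for t
  proof -
    define u v where "u = 1 / t" and "v = 1 / (t + 1)"
    have "1 / (2 * t) = u / 2" "1 / (2 * (t + 1)) = v / 2"
      unfolding u_def v_def by (simp_all only: divide_divide_eq_left mult.commute)
    moreover have "Digamma (t + 1) = Digamma t + u"
      using that unfolding u_def by (intro Digamma_plus1) simp
    ultimately show ?thesis unfolding g_def u_def[symmetric] v_def[symmetric] by simp
  qed
  have gmono: "g t \<le> g (t + 1)" if "t > 0" for t
  proof -
    have "ln (t + 1) - ln t \<le> (1 / t + 1 / (t + 1)) / 2"
      using ln_inverse_approx_le[of t 1] that by (simp only: inverse_eq_divide mult_1 zero_less_one)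
    then show ?thesis using gstep[OF that] by linarith
  qed
  \<comment> \<open>The midpoint rule bounds the same integral below by 2/(2t + 1). The gap between
    the two rules is 1/(2t(t + 1)(2t + 1)), and 4t(t + 1) \<le> (2t + 1)^2 makes it at most a
    difference of consecutive values of 1/(8t^2). This is where the 8 comes from.\<close>
  have hmono: "h (t + 1) \<le> h t" if t: "t > 0" for t
  proof -
    have "g (t + 1) - g t \<le> (1 / t + 1 / (t + 1)) / 2 - 2 / (2 * t + 1)"
      using gstep[OF t] ln_inverse_approx_ge[of t "t + 1"] t by (simp add: add_ac)
    also have "\<dots> = 1 / (2 * t * (t + 1) * (2 * t + 1))"
      using t by (simp add: divide_simps) (simp add: algebra_simps)
    also have "\<dots> = (4 * (t * (t + 1))) / (8 * t\<^sup>2 * (t + 1)\<^sup>2 * (2 * t + 1))"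
      using t by (simp add: divide_simps power2_eq_square) (simp add: algebra_simps)
    also have "\<dots> \<le> (2 * t + 1)\<^sup>2 / (8 * t\<^sup>2 * (t + 1)\<^sup>2 * (2 * t + 1))"
      using t by (intro divide_right_mono) (simp_all add: power2_eq_square algebra_simps)
    also have "\<dots> = 1 / (8 * t\<^sup>2) - 1 / (8 * (t + 1)\<^sup>2)"
      using t by (simp add: divide_simps) (simp add: algebra_simps power2_eq_square)
    finally show ?thesis by (simp add: h_def)
  qed
  have glim: "(\<lambda>n. g (x + real n)) \<longlonglongrightarrow> 0"
  proof -
    have "(\<lambda>n. (Digamma (x + real n) - ln (real n)) + (ln (real n) - ln (x + real n) + 1 / (2 * (x + real n))))
        \<longlonglongrightarrow> 0 + 0"
      by (intro tendsto_add Digamma_plus_of_nat_minus_ln_tendsto_0 x) (use x in real_asymp)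
    then show ?thesis by (simp add: g_def algebra_simps)
  qed
  have hlim: "(\<lambda>n. h (x + real n)) \<longlonglongrightarrow> 0"
  proof -
    have "(\<lambda>n. 1 / (8 * (x + real n)\<^sup>2)) \<longlonglongrightarrow> 0" using x by real_asymp
    from tendsto_add[OF glim this] show ?thesis by (simp add: h_def)
  qed
  have pos: "x + real n > 0" for n using x by (simp add: add_pos_nonneg)
  have "incseq (\<lambda>n. g (x + real n))"
    using gmono[OF pos] by (intro incseq_SucI) (simp add: add_ac)
  from incseq_le[OF this glim, of 0] show "Digamma x \<le> ln x - 1 / (2 * x)"
    by (simp add: g_def)
  have "decseq (\<lambda>n. h (x + real n))"
    using hmono[OF pos] by (intro decseq_SucI) (simp add: add_ac)
  from decseq_ge[OF this hlim, of 0] show "ln x - 1 / (2 * x) - 1 / (8 * x\<^sup>2) \<le> Digamma x"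
    by (simp add: g_def h_def)
qed

text \<open>The terms set against psi(l/a) are exactly the upper bound just proved, at x = l/a, so
  each summand lies between 0 and a^2/(8 l^2).\<close>

lemma summable_S_summand:
  assumes a: "a > 0"
  shows "summable (\<lambda>l. S_summand a (Suc l))"
proof (rule summable_comparison_test')
  have "summable (\<lambda>l. inverse (real (Suc l)) ^ 2)"
    using inverse_power_summable[of 2, where 'a = real] by (subst summable_Suc_iff) (simp add: power_inverse)
  then show "summable (\<lambda>l. a\<^sup>2 / 8 * inverse (real (Suc l)) ^ 2)"
    by (rule summable_mult)
  fix l :: nat
  have "real (Suc l) / a > 0" using a by simp
  from Digamma_real_asymptotic_bounds[OF this]
  show "norm (S_summand a (Suc l)) \<le> a\<^sup>2 / 8 * inverse (real (Suc l)) ^ 2"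
    by (simp add: S_summand_def power_divide inverse_eq_divide)
qed

text \<open>The remainder t decreases and is bounded below, hence converges to some L. Since 2 t(n)
  - t(2n) also tends to L, Wallis' product determines L.\<close>

lemma ln_fact_stirling:
  "(\<lambda>n. ln (fact n) - (real n + 1/2) * ln (real n) + real n) \<longlonglongrightarrow> ln (2 * pi) / 2"
proof -
  define t where "t = (\<lambda>n. ln (fact n) - (real n + 1/2) * ln (real n) + real n)"
  have step: "t (Suc n) = t n + 1 - (real n + 1/2) * (ln (real n + 1) - ln (real n))" for n
  proof -
    have "ln (fact (Suc n)) = ln (real n + 1) + ln (fact n)"
      by (simp add: ln_mult add_ac add_pos_nonneg)
    then show ?thesis by (simp add: t_def algebra_simps)
  qed
  have dec: "t (Suc n) \<le> t n" if n: "n > 0" for n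
  proof -
    have "(real n + 1/2) * (2 / (2 * real n + 1)) \<le> (real n + 1/2) * (ln (real n + 1) - ln (real n))"
      using ln_inverse_approx_ge[of "real n" "real n + 1"] n
      by (intro mult_left_mono) (auto simp: add_ac)
    moreover have "(real n + 1/2) * (2 / (2 * real n + 1)) = 1"
      by (simp add: field_simps)
    ultimately show ?thesis using step[of n] by linarith
  qed
  \<comment> \<open>The trapezoidal bound exceeds 1 by 1/(4n(n + 1)) = 1/(4n) - 1/(4(n + 1)), so
    subtracting 1/(4n) from t(n) gives an increasing sequence; it bounds t from below.\<close>
  have inc: "t n - 1 / (4 * real n) \<le> t (Suc n) - 1 / (4 * real (Suc n))" if n: "n > 0" for n
  proof -
    have "(real n + 1/2) * (ln (real n + 1) - ln (real n)) \<le>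
        (real n + 1/2) * ((1 / real n + 1 / (real n + 1)) / 2)"
      using ln_inverse_approx_le[of "real n" 1] n
      by (intro mult_left_mono) (auto simp: inverse_eq_divide)
    also have "\<dots> = 1 + 1 / (4 * real n) - 1 / (4 * real (Suc n))"
      using n by (simp add: divide_simps) (simp add: algebra_simps)
    finally show ?thesis using step[of n] by linarith
  qed
  have lb: "t (Suc 0) - 1 / 4 \<le> t (Suc n) - 1 / (4 * real (Suc n))" for n
  proof (induction n)
    case (Suc n)
    then show ?case using inc[of "Suc n"] by linarith
  qed simp
  have "t (Suc 0) - 1 / 4 \<le> t (Suc n)" for n
    using lb[of n] by (smt (verit) divide_nonneg_nonneg of_nat_0_le_iff)
  \<comment> \<open>The shift by \<open>Suc\<close> skips n = 0, for which monotonicity was not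
    shown.\<close>
  moreover have "decseq (\<lambda>n. t (Suc n))"
    using dec by (intro decseq_SucI) simp
  ultimately obtain L where "(\<lambda>n. t (Suc n)) \<longlonglongrightarrow> L"
    using decseq_convergent by blast
  then have L: "t \<longlonglongrightarrow> L" by (subst (asm) filterlim_sequentially_Suc)
  have "filterlim (\<lambda>n::nat. 2 * n) sequentially sequentially"
    by (rule filterlim_subseq) (simp add: strict_mono_def)
  from filterlim_compose[OF L this] have L2: "(\<lambda>n. t (2 * n)) \<longlonglongrightarrow> L" .
  \<comment> \<open>In 2 t(n) - t(2n) the terms of order n ln n and n cancel up to a multiple of ln
    2. Doubling it produces n!^4 2^(4n) / (2n)!^2, which is W(n) (2n + 1).\<close>
  have lim1: "(\<lambda>n. 2 * (2 * t n - t (2 * n))) \<longlonglongrightarrow> 2 * (2 * L - L)"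
    by (intro tendsto_intros L L2)
  define W where "W = (\<lambda>n. \<Prod>k=1..n. (4*real k^2) / (4*real k^2 - 1))"
  have Wfact: "W n = 2 ^ (4 * n) * fact n ^ 4 / ((fact (2 * n))\<^sup>2 * (2 * real n + 1))" for n
  proof (induction n)
    case (Suc n)
    have "4 * real (Suc n)^2 - 1 = (2 * real n + 1) * (2 * real n + 3)"
      by (simp add: algebra_simps power2_eq_square)
    then have "W (Suc n) = W n * (4 * (real n + 1)\<^sup>2 / ((2 * real n + 1) * (2 * real n + 3)))"
      by (simp add: W_def add_ac)
    also have "\<dots> = 2 ^ (4 * Suc n) * fact (Suc n) ^ 4 / ((fact (2 * Suc n))\<^sup>2 * (2 * real (Suc n) + 1))"
    proof -
      have "fact (2 * Suc n) = (2 * real n + 2) * (2 * real n + 1) * fact (2 * n)"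
        by (simp add: algebra_simps)
      moreover have "fact (Suc n) = (real n + 1) * fact n" by (simp add: algebra_simps)
      moreover have "(2::real) ^ (4 * Suc n) = 16 * 2 ^ (4 * n)" by (simp add: power_add)
      moreover have "2 * real n + 1 \<noteq> 0" "2 * real n + 3 \<noteq> 0" "real n + 1 \<noteq> 0" "2 * real n + 2 \<noteq> 0"
        using of_nat_0_le_iff[of n, where 'a = real] by linarith+
      ultimately show ?thesis
        unfolding Suc by (simp only:) (simp add: divide_simps, simp add: power2_eq_square eval_nat_numeral algebra_simps)
    qed
    finally show ?case .
  qed (simp add: W_def)
  have lnW: "2 * (2 * t n - t (2 * n)) = ln (W n) + (ln (2 * real n + 1) - ln (real n)) + ln 2"
    if "n > 0" for n
  proof -
    have "ln (W n) = ln (2 ^ (4 * n)) + ln (fact n ^ 4) - (ln ((fact (2 * n))\<^sup>2) + ln (2 * real n + 1))"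
      unfolding Wfact by (subst ln_div ln_mult; simp add: add_pos_nonneg)+
    also have "\<dots> = 4 * real n * ln 2 + 4 * ln (fact n) - 2 * ln (fact (2 * n)) - ln (2 * real n + 1)"
      by (simp add: ln_realpow)
    finally show ?thesis
      using that by (simp add: t_def ln_mult algebra_simps diff_divide_distrib)
  qed
  have "(\<lambda>n. ln (W n) + (ln (2 * real n + 1) - ln (real n)) + ln 2) \<longlonglongrightarrow> ln (pi / 2) + ln 2 + ln 2"
  proof (intro tendsto_add tendsto_ln tendsto_const)
    show "W \<longlonglongrightarrow> pi / 2" unfolding W_def by (rule wallis)
    show "(\<lambda>n. ln (2 * real n + 1) - ln (real n)) \<longlonglongrightarrow> ln 2" by real_asymp
  qed simp_all
  moreover have "eventually (\<lambda>n. ln (W n) + (ln (2 * real n + 1) - ln (real n)) + ln 2 =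
      2 * (2 * t n - t (2 * n))) sequentially"
    using eventually_gt_at_top[of 0] by eventually_elim (rule lnW[symmetric])
  ultimately have "(\<lambda>n. 2 * (2 * t n - t (2 * n))) \<longlonglongrightarrow> ln (pi / 2) + ln 2 + ln 2"
    by (rule Lim_transform_eventually)
  from LIMSEQ_unique[OF lim1 this] have "L = ln (2 * pi) / 2"
    by (simp add: ln_mult ln_div)
  with L show ?thesis by (simp add: t_def)
qed

text \<open>The sum telescopes: x psi(x + 1) = x psi(x) + 1 shows that (x - 1) psi(x) - x increases
  by psi(x) when x increases by 1.\<close>

lemma sum_Digamma_plus_of_nat:
  fixes x :: real
  assumes x: "x > 0"
  shows "(\<Sum>q<N. Digamma (x + real q)) =
    ((x + real N - 1) * Digamma (x + real N) - (x + real N)) - ((x - 1) * Digamma x - x)"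
proof (induction N)
  case (Suc N)
  have pos: "x + real N > 0" using x by (simp add: add_pos_nonneg)
  have "Digamma (x + real (Suc N)) = Digamma (x + real N) + 1 / (x + real N)"
    using Digamma_plus1[of "x + real N"] pos by (simp add: add_ac)
  then have "(x + real (Suc N) - 1) * Digamma (x + real (Suc N)) =
      (x + real N) * Digamma (x + real N) + 1"
    using pos by (simp add: distrib_left)
  with Suc show ?case by (simp add: algebra_simps)
qed simp

text \<open>Replacing psi(x) by ln x - 1/(2x) costs O(1/x^2), which still vanishes after
  multiplication by the linear factor. In the elementary remainder the constant y from expanding the
  logarithm cancels against -y, so the limit -1/2, due to the term -1/(2x), is the same for all
  y.\<close>

lemma Digamma_antidifference_asymptotics:
  fixes y :: real
  assumes y: "y > 0"
  shows "(\<lambda>N. ((y + real N - 1) * Digamma (y + real N) - (y + real N))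
      - (real N * ln (real N) - real N + (y - 1) * ln (real N))) \<longlonglongrightarrow> - 1/2"
proof -
  define g where "g = (\<lambda>x::real. Digamma x - ln x + 1 / (2 * x))"
  have "(\<lambda>N. (y + real N - 1) * g (y + real N)) \<longlonglongrightarrow> 0"
  proof (rule Lim_null_comparison)
    show "eventually (\<lambda>N. norm ((y + real N - 1) * g (y + real N)) \<le>
        (y + real N + 1) * (1 / (8 * (y + real N)\<^sup>2))) sequentially"
    proof (rule always_eventually, rule allI)
      fix N
      have "y + real N > 0" using y by (simp add: add_pos_nonneg)
      from Digamma_real_asymptotic_bounds[OF this]
      have "\<bar>g (y + real N)\<bar> \<le> 1 / (8 * (y + real N)\<^sup>2)" by (simp add: g_def abs_le_iff)
      moreover have "\<bar>y + real N - 1\<bar> \<le> y + real N + 1" using y by linarith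
      ultimately show "norm ((y + real N - 1) * g (y + real N)) \<le>
          (y + real N + 1) * (1 / (8 * (y + real N)\<^sup>2))"
        unfolding real_norm_def abs_mult by (intro mult_mono) auto
    qed
    show "(\<lambda>N. (y + real N + 1) * (1 / (8 * (y + real N)\<^sup>2))) \<longlonglongrightarrow> 0"
      using y by real_asymp
  qed
  moreover have "(\<lambda>N. (y + real N - 1) * (ln (y + real N) - 1 / (2 * (y + real N))) - (y + real N)
      - (real N * ln (real N) - real N + (y - 1) * ln (real N))) \<longlonglongrightarrow> - 1/2"
    using y by real_asymp
  ultimately have "(\<lambda>N. (y + real N - 1) * g (y + real N) +
      ((y + real N - 1) * (ln (y + real N) - 1 / (2 * (y + real N))) - (y + real N)
      - (real N * ln (real N) - real N + (y - 1) * ln (real N)))) \<longlonglongrightarrow> 0 + - 1/2"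
    by (rule tendsto_add)
  then show ?thesis by (simp add: g_def algebra_simps)
qed

section \<open>Finite sums at rational arguments\<close>

text \<open>This is the multiplication formula at z = 1/m: the left side and the last summand are
  both psi(1) = -gamma.\<close>

lemma sum_Digamma_rational:
  assumes m: "m > 0"
  shows "(\<Sum>j = 1..m - 1. Digamma (real j / real m)) =
    - (real m - 1) * euler_mascheroni - real m * ln (real m)"
proof -
  have "Digamma (real m * (1 / real m)) =
      ln (real m) + (\<Sum>j<m. Digamma (1 / real m + real j / real m)) / real m"
    using m by (intro Digamma_multiplication) (simp_all add: add_divide_distrib[symmetric])
  then have "- euler_mascheroni = ln (real m) + (\<Sum>j<m. Digamma (real (Suc j) / real m)) / real m"
    using m by (simp add: add_divide_distrib)
  moreover have "(\<Sum>j<m. Digamma (real (Suc j) / real m)) =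
      (\<Sum>j = 1..m - 1. Digamma (real j / real m)) - euler_mascheroni"
  proof -
    have "(\<Sum>j<m. Digamma (real (Suc j) / real m)) = (\<Sum>j = 1..m. Digamma (real j / real m))"
      by (simp add: sum.atLeast1_atMost_eq)
    also have "{1..m} = insert m {1..m - 1}" using m by auto
    finally show ?thesis using m by simp
  qed
  ultimately show ?thesis using m by (simp add: field_simps)
qed

lemma real_divide_not_Ints:
  assumes "0 < j" "j < m"
  shows "real j / real m \<notin> \<int>"
proof
  assume "real j / real m \<in> \<int>"
  then obtain k :: int where k: "real j / real m = of_int k" by (elim Ints_cases)
  have "0 < real j / real m" "real j / real m < 1" using assms by simp_all
  then show False unfolding k by simp
qed

lemma sum_reflect_nat:
  fixes f :: "nat \<Rightarrow> real"
  assumes "m > 0"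
  shows "(\<Sum>j = 1..m - 1. f j) = (\<Sum>j = 1..m - 1. f (m - j))"
  using assms by (subst sum.atLeastAtMost_rev) simp

text \<open>With t = j/m, average the sum with its image under t -> 1 - t. The deviation of t from
  1/2 is odd under this symmetry, so it meets only psi(1 - t) - psi(t), a cotangent by
  reflection.\<close>

lemma sum_mult_Digamma_rational:
  assumes m: "m > 0"
  shows "(\<Sum>j = 1..m - 1. real j / real m * Digamma (real j / real m)) =
    (\<Sum>j = 1..m - 1. Digamma (real j / real m)) / 2
    + pi / 2 * (\<Sum>j = 1..m - 1. (1/2 - real j / real m) * cot (pi * (real j / real m)))"
proof -
  define A where "A = (\<Sum>j = 1..m - 1. Digamma (real j / real m))"
  define B where "B = (\<Sum>j = 1..m - 1. real j / real m * Digamma (real j / real m))"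
  have sub: "real (m - j) / real m = 1 - real j / real m" if "j \<in> {1..m - 1}" for j
  proof -
    have "j \<le> m" using that m by auto
    then show ?thesis using m by (simp add: field_simps of_nat_diff)
  qed
  have A': "A = (\<Sum>j = 1..m - 1. Digamma (1 - real j / real m))"
    unfolding A_def by (subst sum_reflect_nat[OF m]) (rule sum.cong[OF refl], simp only: sub)
  have B': "B = (\<Sum>j = 1..m - 1. (1 - real j / real m) * Digamma (1 - real j / real m))"
    unfolding B_def by (subst sum_reflect_nat[OF m]) (rule sum.cong[OF refl], simp only: sub)
  have "B + B - (A + A) / 2 = (\<Sum>j = 1..m - 1.
      real j / real m * Digamma (real j / real m)
      + (1 - real j / real m) * Digamma (1 - real j / real m)
      - (Digamma (real j / real m) + Digamma (1 - real j / real m)) / 2)"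
    by (subst (2) A', subst (2) B', subst A_def, subst B_def)
       (simp only: sum.distrib sum_subtractf sum_divide_distrib[symmetric])
  also have "\<dots> = (\<Sum>j = 1..m - 1. pi * ((1/2 - real j / real m) * cot (pi * (real j / real m))))"
  proof (rule sum.cong[OF refl])
    fix j assume j: "j \<in> {1..m - 1}"
    define t where "t = real j / real m"
    have "t \<notin> \<int>" unfolding t_def using j by (intro real_divide_not_Ints) auto
    then have d: "Digamma (1 - t) = Digamma t + pi * cot (pi * t)"
      using Digamma_reflection_real[of t] by simp
    show "real j / real m * Digamma (real j / real m)
      + (1 - real j / real m) * Digamma (1 - real j / real m)
      - (Digamma (real j / real m) + Digamma (1 - real j / real m)) / 2 =
      pi * ((1/2 - real j / real m) * cot (pi * (real j / real m)))"
      unfolding t_def[symmetric] d by (simp add: field_simps)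
  qed
  finally show ?thesis
    unfolding A_def B_def by (simp only: sum_distrib_left[symmetric]) (simp add: field_simps)
qed

section \<open>Sums over the grid of points r/n + j/m\<close>

lemma coprime_mult_divide_not_Ints:
  assumes "coprime m n" "0 < r" "r < n"
  shows "real m * (real r / real n) \<notin> \<int>"
proof
  assume "real m * (real r / real n) \<in> \<int>"
  then obtain k :: int where "real m * (real r / real n) = of_int k" by (elim Ints_cases)
  then have "real_of_int (int (m * r)) = real_of_int (k * int n)"
    using assms by (simp add: field_simps)
  then have "int (m * r) = k * int n" by (simp only: of_int_eq_iff)
  then have "int n dvd int (m * r)" by simp
  then have "n dvd m * r" by (simp only: int_dvd_int_iff)
  then have "n dvd r" using assms by (simp add: coprime_commute coprime_dvd_mult_right_iff)
  then show False using assms by (simp add: nat_dvd_not_less)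
qed

lemma sum_cot_interior:
  assumes "coprime m n" "0 < r" "r < n" and m: "m > 0"
  shows "(\<Sum>j = 1..m - 1. cot (pi * (real r / real n + real j / real m))) =
    real m * cot (pi * (real m * (real r / real n))) - cot (pi * (real r / real n))"
proof -
  have "{..<m} = insert 0 {1..m - 1}" using m by auto
  then have "(\<Sum>j<m. cot (pi * (real r / real n + real j / real m))) =
      cot (pi * (real r / real n)) + (\<Sum>j = 1..m - 1. cot (pi * (real r / real n + real j / real m)))"
    by simp
  then show ?thesis
    using sum_cot_equidistant[OF m coprime_mult_divide_not_Ints[OF assms(1-3)]] by simp
qed

lemma sum_Digamma_interior:
  assumes m: "m > 0" and n: "n > 0" and cop: "coprime m n"
  defines "y \<equiv> \<lambda>r j. real r / real n + real j / real m"
  shows "(\<Sum>r = 1..n - 1. \<Sum>j = 1..m - 1. (y r j - 1) * Digamma (y r j)) =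
    (real m - 1) * (real n - 1) / 2
    + pi / 2 * (\<Sum>r = 1..n - 1. (1/2 - real r / real n) *
        (real m * cot (pi * (real m * (real r / real n))) - cot (pi * (real r / real n))))
    + pi / 2 * (\<Sum>j = 1..m - 1. (1/2 - real j / real m) *
        (real n * cot (pi * (real n * (real j / real m))) - cot (pi * (real j / real m))))"
proof -
  define G where "G = (\<lambda>y::real. (y - 1) * Digamma y)"
  have refl_y: "y (n - r) (m - j) = 2 - y r j" if "r \<in> {1..n - 1}" "j \<in> {1..m - 1}" for r j
  proof -
    have "r \<le> n" "j \<le> m" using that by auto
    then show ?thesis using m n by (simp add: y_def field_simps of_nat_diff)
  qed
  \<comment> \<open>Reflection and one step of the recurrence give G(y) + G(2 - y) = 1 + (1 - y) pi
    cot(pi y). Splitting 1 - y as (1/2 - r/n) + (1/2 - j/m) leaves weights that depend on one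
    coordinate each. Coprimality keeps y off the integers.\<close>
  have pair: "G (y r j) + G (2 - y r j) =
      1 + pi * ((1/2 - real r / real n) * cot (pi * y r j) + (1/2 - real j / real m) * cot (pi * y r j))"
    if "r \<in> {1..n - 1}" "j \<in> {1..m - 1}" for r j
  proof -
    have "y r j \<notin> \<int>"
    proof
      assume "y r j \<in> \<int>"
      then have "real m * y r j - real j \<in> \<int>" by (intro Ints_diff Ints_mult) auto
      moreover have "real m * y r j - real j = real m * (real r / real n)"
        using m by (simp add: y_def field_simps)
      moreover have "0 < r" "r < n" using that by auto
      ultimately show False using coprime_mult_divide_not_Ints[OF cop] by metis
    qed
    then have d: "Digamma (1 - y r j) = Digamma (y r j) + pi * cot (pi * y r j)"
      and ne: "1 - y r j \<noteq> 0"
      using Digamma_reflection_real[of "y r j"] by auto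
    have "Digamma (2 - y r j) = Digamma (1 - y r j) + 1 / (1 - y r j)"
      using Digamma_plus1[OF ne] by (simp add: algebra_simps)
    then have "(1 - y r j) * Digamma (2 - y r j) =
        (1 - y r j) * (Digamma (y r j) + pi * cot (pi * y r j)) + 1"
      using ne by (simp add: d distrib_left)
    moreover have "1/2 - real r / real n + (1/2 - real j / real m) = 1 - y r j"
      by (simp add: y_def)
    ultimately show ?thesis
      unfolding distrib_right[symmetric] by (simp add: G_def algebra_simps)
  qed
  define I where "I = (\<Sum>r = 1..n - 1. \<Sum>j = 1..m - 1. G (y r j))"
  have "I = (\<Sum>r = 1..n - 1. \<Sum>j = 1..m - 1. G (y (n - r) (m - j)))"
    unfolding I_def by (subst sum_reflect_nat[OF n], subst sum_reflect_nat[OF m]) simp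
  also have "\<dots> = (\<Sum>r = 1..n - 1. \<Sum>j = 1..m - 1. G (2 - y r j))"
    by (intro sum.cong refl) (simp only: refl_y)
  finally have "I + I = (\<Sum>r = 1..n - 1. \<Sum>j = 1..m - 1. G (y r j) + G (2 - y r j))"
    by (simp add: I_def sum.distrib)
  also have "\<dots> = (\<Sum>r = 1..n - 1. \<Sum>j = 1..m - 1.
      1 + pi * ((1/2 - real r / real n) * cot (pi * y r j) + (1/2 - real j / real m) * cot (pi * y r j)))"
    by (intro sum.cong refl) (simp only: pair)
  also have "\<dots> = real (n - 1) * real (m - 1)
      + pi * (\<Sum>r = 1..n - 1. \<Sum>j = 1..m - 1. (1/2 - real r / real n) * cot (pi * y r j))
      + pi * (\<Sum>r = 1..n - 1. \<Sum>j = 1..m - 1. (1/2 - real j / real m) * cot (pi * y r j))"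
    by (simp only: distrib_left sum.distrib) (simp add: sum_distrib_left)
  also have "(\<Sum>r = 1..n - 1. \<Sum>j = 1..m - 1. (1/2 - real r / real n) * cot (pi * y r j)) =
      (\<Sum>r = 1..n - 1. (1/2 - real r / real n) *
        (real m * cot (pi * (real m * (real r / real n))) - cot (pi * (real r / real n))))"
  proof (rule sum.cong[OF refl])
    fix r assume "r \<in> {1..n - 1}"
    then have "0 < r" "r < n" by auto
    from sum_cot_interior[OF cop this m]
    show "(\<Sum>j = 1..m - 1. (1/2 - real r / real n) * cot (pi * y r j)) =
      (1/2 - real r / real n) *
        (real m * cot (pi * (real m * (real r / real n))) - cot (pi * (real r / real n)))"
      by (simp only: sum_distrib_left[symmetric] y_def)
  qed
  also have "(\<Sum>r = 1..n - 1. \<Sum>j = 1..m - 1. (1/2 - real j / real m) * cot (pi * y r j)) =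
      (\<Sum>j = 1..m - 1. \<Sum>r = 1..n - 1. (1/2 - real j / real m) * cot (pi * y r j))"
    by (rule sum.swap)
  also have "\<dots> = (\<Sum>j = 1..m - 1. (1/2 - real j / real m) *
        (real n * cot (pi * (real n * (real j / real m))) - cot (pi * (real j / real m))))"
  proof (rule sum.cong[OF refl])
    fix j assume "j \<in> {1..m - 1}"
    then have "0 < j" "j < m" by auto
    from sum_cot_interior[OF _ this n] cop
    have "(\<Sum>r = 1..n - 1. cot (pi * (real j / real m + real r / real n))) =
      real n * cot (pi * (real n * (real j / real m))) - cot (pi * (real j / real m))"
      by (simp add: coprime_commute)
    then show "(\<Sum>r = 1..n - 1. (1/2 - real j / real m) * cot (pi * y r j)) =
      (1/2 - real j / real m) *
        (real n * cot (pi * (real n * (real j / real m))) - cot (pi * (real j / real m)))"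
      by (simp only: sum_distrib_left[symmetric] y_def add.commute)
  qed
  finally show ?thesis
    using m n by (simp add: I_def G_def of_nat_diff field_simps)
qed

text \<open>The edges j = 0 and r = n are added to the interior; their corner y = 1 contributes 0.
  The sums of cot(pi r/n) and cot(pi j/m) that the edges produce cancel those left over from the
  interior.\<close>

lemma sum_Digamma_grid:
  assumes m: "m > 0" and n: "n > 0" and cop: "coprime m n"
  defines "y \<equiv> \<lambda>r j. real r / real n + real j / real m"
  shows "(\<Sum>r = 1..n. \<Sum>j<m. (y r j - 1) * Digamma (y r j)) =
    (real m - 1) * (real n + 1) / 2
    + (euler_mascheroni * (real n - real m) - real m * ln (real m) + real n * ln (real n)) / 2
    + pi / 2 * real m * (\<Sum>r = 1..n - 1. (1/2 - real r / real n) * cot (pi * (real m * (real r / real n))))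
    + pi / 2 * real n * (\<Sum>j = 1..m - 1. (1/2 - real j / real m) * cot (pi * (real n * (real j / real m))))"
proof -
  define G where "G = (\<lambda>y::real. (y - 1) * Digamma y)"
  have sn: "{1..n} = insert n {1..n - 1}" and sm: "{..<m} = insert 0 {1..m - 1}"
    using m n by auto
  have "(\<Sum>r = 1..n. \<Sum>j<m. G (y r j)) =
      (\<Sum>r = 1..n - 1. \<Sum>j = 1..m - 1. G (y r j)) + (\<Sum>r = 1..n - 1. G (y r 0))
      + (\<Sum>j = 1..m - 1. G (y n j)) + G (y n 0)"
    using n unfolding sn sm by (simp add: sum.distrib)
  also have "G (y n 0) = 0" using n by (simp add: G_def y_def)
  also have "(\<Sum>r = 1..n - 1. G (y r 0)) =
      (\<Sum>r = 1..n - 1. real r / real n * Digamma (real r / real n))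
      - (\<Sum>r = 1..n - 1. Digamma (real r / real n))"
    by (simp add: G_def y_def left_diff_distrib sum_subtractf)
  also have "(\<Sum>j = 1..m - 1. G (y n j)) =
      (\<Sum>j = 1..m - 1. real j / real m * Digamma (real j / real m)) + real (m - 1)"
  proof -
    have "G (y n j) = real j / real m * Digamma (real j / real m) + 1" if "j \<in> {1..m - 1}" for j
    proof -
      have "Digamma (real j / real m + 1) = Digamma (real j / real m) + 1 / (real j / real m)"
        using that m by (intro Digamma_plus1) auto
      then show ?thesis
        using that m n by (simp add: G_def y_def add.commute distrib_left)
    qed
    then show ?thesis by (simp add: sum.distrib)
  qed
  finally show ?thesis
    unfolding G_def y_def sum_Digamma_interior[OF m n cop]
      sum_mult_Digamma_rational[OF m] sum_mult_Digamma_rational[OF n]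
      sum_Digamma_rational[OF m] sum_Digamma_rational[OF n]
    using m n by (simp add: right_diff_distrib sum_subtractf sum_distrib_left of_nat_diff)
      (simp add: sum_distrib_left field_simps)
qed

text \<open>This total is the coefficient of ln N when the antidifference asymptotics are added up
  over the grid.\<close>

lemma sum_grid_minus_1:
  assumes m: "m > 0" and n: "n > 0"
  shows "(\<Sum>r = 1..n. \<Sum>j<m. real r / real n + real j / real m - 1) = (real m - real n) / 2"
proof -
  have 1: "(\<Sum>r = 1..n. real r) = real n * (real n + 1) / 2"
    by (induction n) (simp_all add: field_simps)
  have 2: "(\<Sum>j<m. real j) = real m * (real m - 1) / 2"
    by (induction m) (simp_all add: field_simps)
  have 3: "(\<Sum>r = 1..n. \<Sum>j<m. real r / real n + real j / real m - 1) =
      real m * (\<Sum>r = 1..n. real r) / real n + real n * (\<Sum>j<m. real j) / real m - real m * real n"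
    by (simp add: sum.distrib sum_subtractf sum_divide_distrib[symmetric] sum_distrib_left[symmetric])
  show ?thesis unfolding 3 1 2 using m n by (simp add: field_simps)
qed

text \<open>Write the index as n q + r with 1 \<le> r \<le> n, which keeps every y positive. The
  argument is then m (q + r/n), to which the multiplication formula applies, and the sum over q
  telescopes.\<close>

lemma sum_Digamma_progression:
  assumes m: "m > 0" and n: "n > 0"
  defines "y \<equiv> \<lambda>r j. real r / real n + real j / real m"
  shows "(\<Sum>l<n * N. Digamma (real (Suc l) * real m / real n)) = real (n * N) * ln (real m)
    + (\<Sum>r = 1..n. \<Sum>j<m. ((y r j + real N - 1) * Digamma (y r j + real N) - (y r j + real N))
        - ((y r j - 1) * Digamma (y r j) - y r j)) / real m"
proof -
  have y: "y (Suc r) j > 0" for r j using n by (simp add: y_def add_pos_nonneg)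
  have "(\<Sum>l<n * N. Digamma (real (Suc l) * real m / real n)) =
      (\<Sum>q<N. \<Sum>r<n. Digamma (real (Suc (n * q + r)) * real m / real n))"
    by (rule sum_lessThan_mult_split)
  also have "\<dots> = (\<Sum>q<N. \<Sum>r<n. ln (real m) + (\<Sum>j<m. Digamma (y (Suc r) j + real q)) / real m)"
  proof (intro sum.cong refl)
    fix q r
    let ?z = "real (Suc r) / real n + real q"
    have "real (Suc (n * q + r)) * real m / real n = real m * ?z"
      using n by (simp add: field_simps)
    moreover have "Digamma (real m * ?z) = ln (real m) + (\<Sum>j<m. Digamma (?z + real j / real m)) / real m"
    proof (rule Digamma_multiplication[OF m])
      fix j
      show "?z + real j / real m \<noteq> 0" using y[of r j] by (simp add: y_def)
    qed
    ultimately show "Digamma (real (Suc (n * q + r)) * real m / real n) =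
        ln (real m) + (\<Sum>j<m. Digamma (y (Suc r) j + real q)) / real m"
      by (simp only: y_def) (simp only: add_ac)
  qed
  also have "\<dots> = real (n * N) * ln (real m)
      + (\<Sum>q<N. \<Sum>r<n. \<Sum>j<m. Digamma (y (Suc r) j + real q)) / real m"
    by (simp add: sum.distrib sum_divide_distrib[symmetric])
  also have "(\<Sum>q<N. \<Sum>r<n. \<Sum>j<m. Digamma (y (Suc r) j + real q)) =
      (\<Sum>r<n. \<Sum>j<m. \<Sum>q<N. Digamma (y (Suc r) j + real q))"
    by (subst sum.swap) (intro sum.cong refl sum.swap)
  finally show ?thesis
    by (simp only: sum_Digamma_plus_of_nat[OF y] sum.atLeast1_atMost_eq One_nat_def)
qed

section \<open>Evaluation of the series\<close>

text \<open>Since the series converges, its partial sums may be taken at multiples of n. There they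
  are a constant plus three convergent remainders: Stirling's \<open>T\<close>, the harmonic one,
  and the errors \<open>E\<close> of the antidifference.\<close>

lemma S_rational_eq_grid:
  assumes m: "m > 0" and n: "n > 0"
  defines "y \<equiv> \<lambda>r j. real r / real n + real j / real m"
  shows "S (real n / real m) = ln (2 * pi) / 2 - real n / (2 * real m) * euler_mascheroni + real n / 2
    + (\<Sum>r = 1..n. \<Sum>j<m. (y r j - 1) * Digamma (y r j) - y r j) / real m
    + ln (real n) / 2 - real n / (2 * real m) * ln (real n)"
proof -
  define F where "F = (\<lambda>y::real. (y - 1) * Digamma y - y)"
  define E where "E = (\<lambda>y N. F (y + real N) - (real N * ln (real N) - real N + (y - 1) * ln (real N)))"
  define T where "T = (\<lambda>M. ln (fact M) - (real M + 1/2) * ln (real M) + real M)"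
  define SF where "SF = (\<Sum>r = 1..n. \<Sum>j<m. F (y r j))"
  have y: "y r j > 0" if "r \<in> {1..n}" for r j using that n by (simp add: y_def add_pos_nonneg)
  have sub: "filterlim (\<lambda>N. n * N) sequentially sequentially"
    by (rule filterlim_subseq) (simp add: strict_mono_def n)
  have "summable (\<lambda>l. S_summand (real n / real m) (Suc l))"
    using m n by (intro summable_S_summand) simp
  then have "(\<lambda>M. \<Sum>l<M. S_summand (real n / real m) (Suc l)) \<longlonglongrightarrow> S (real n / real m)"
    unfolding S_def by (rule summable_LIMSEQ)
  from filterlim_compose[OF this sub]
  have lim: "(\<lambda>N. \<Sum>l<n * N. S_summand (real n / real m) (Suc l)) \<longlonglongrightarrow> S (real n / real m)" .
  have part: "(\<Sum>l<M. S_summand (real n / real m) (Suc l)) =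
      ln (fact M) + real M * (ln (real m) - ln (real n)) - real n / (2 * real m) * harm M
      - (\<Sum>l<M. Digamma (real (Suc l) * real m / real n))" for M
  proof (induction M)
    case (Suc M)
    have "ln (fact (Suc M)) = ln (real (Suc M)) + ln (fact M)"
      by (simp add: ln_mult add_pos_nonneg)
    moreover have "S_summand (real n / real m) (Suc M) =
        ln (real (Suc M)) + (ln (real m) - ln (real n)) - real n / (2 * real m) * inverse (real (Suc M))
        - Digamma (real (Suc M) * real m / real n)"
    proof -
      have "ln (real (Suc M) / (real n / real m)) = ln (real (Suc M)) + (ln (real m) - ln (real n))"
        using m n by (simp add: ln_div ln_mult del: of_nat_Suc)
      then show ?thesis by (simp add: S_summand_def field_simps)
    qed
    moreover have "real (Suc M) * c = real M * c + c" for c :: real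
      by (simp add: distrib_right)
    note this[of "ln (real m)"] this[of "ln (real n)"]
    ultimately show ?case using Suc
      by (simp add: harm_Suc algebra_simps add_divide_distrib del: of_nat_Suc fact_Suc)
  qed (simp add: harm_def)
  \<comment> \<open>All growing terms cancel exactly. Expanding ln (n N) leaves (ln n)/2 from
    Stirling's formula and -n/(2m) ln n from the harmonic sum.\<close>
  have eq: "(\<Sum>l<n * N. S_summand (real n / real m) (Suc l)) =
      T (n * N) - real n / (2 * real m) * (harm (n * N) - ln (real (n * N)))
      - (\<Sum>r = 1..n. \<Sum>j<m. E (y r j) N) / real m + SF / real m
      + ln (real n) / 2 - real n / (2 * real m) * ln (real n)" if N: "N > 0" for N
  proof -
    have sE: "(\<Sum>r = 1..n. \<Sum>j<m. E (y r j) N) =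
        (\<Sum>r = 1..n. \<Sum>j<m. F (y r j + real N))
        - real n * real m * (real N * ln (real N) - real N) - (real m - real n) / 2 * ln (real N)"
    proof -
      have "(\<Sum>r = 1..n. \<Sum>j<m. E (y r j) N) =
        (\<Sum>r = 1..n. \<Sum>j<m. F (y r j + real N))
        - real n * real m * (real N * ln (real N) - real N)
        - (\<Sum>r = 1..n. \<Sum>j<m. y r j - 1) * ln (real N)"
        unfolding E_def by (simp add: sum.distrib sum_subtractf sum_distrib_right)
          (simp add: algebra_simps sum_subtractf sum_distrib_left)
      then show ?thesis unfolding y_def sum_grid_minus_1[OF m n] .
    qed
    have D: "(\<Sum>l<n * N. Digamma (real (Suc l) * real m / real n)) = real (n * N) * ln (real m)
        + ((\<Sum>r = 1..n. \<Sum>j<m. F (y r j + real N)) - SF) / real m"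
      unfolding sum_Digamma_progression[OF m n] y_def SF_def F_def by (simp only: sum_subtractf)
    have L: "ln (real (n * N)) = ln (real n) + ln (real N)"
      using n N by (simp add: ln_mult)
    show ?thesis
      unfolding part sE T_def D L using m by (simp add: field_simps)
  qed
  \<comment> \<open>Each of the m n errors \<open>E\<close> tends to -1/2; after division by -m they
    account for the term n/2.\<close>
  have "(\<lambda>N. T (n * N) - real n / (2 * real m) * (harm (n * N) - ln (real (n * N)))
      - (\<Sum>r = 1..n. \<Sum>j<m. E (y r j) N) / real m + SF / real m
      + ln (real n) / 2 - real n / (2 * real m) * ln (real n)) \<longlonglongrightarrow>
      ln (2 * pi) / 2 - real n / (2 * real m) * euler_mascheroni
      - (\<Sum>r = 1..n. \<Sum>j<m. - 1/2) / real m + SF / real m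
      + ln (real n) / 2 - real n / (2 * real m) * ln (real n)"
  proof (intro tendsto_add tendsto_diff tendsto_mult tendsto_divide tendsto_const tendsto_sum)
    show "(\<lambda>N. T (n * N)) \<longlonglongrightarrow> ln (2 * pi) / 2"
      using filterlim_compose[OF ln_fact_stirling sub] by (simp only: T_def)
    show "(\<lambda>N. harm (n * N) - ln (real (n * N))) \<longlonglongrightarrow> euler_mascheroni"
      by (rule filterlim_compose[OF euler_mascheroni_LIMSEQ sub])
    show "(\<lambda>N. E (y r j) N) \<longlonglongrightarrow> - 1/2" if "r \<in> {1..n}" for r j
      using Digamma_antidifference_asymptotics[OF y[OF that]] by (simp only: E_def F_def)
  qed (use m in auto)
  moreover have "eventually (\<lambda>N. T (n * N) - real n / (2 * real m) * (harm (n * N) - ln (real (n * N)))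
      - (\<Sum>r = 1..n. \<Sum>j<m. E (y r j) N) / real m + SF / real m
      + ln (real n) / 2 - real n / (2 * real m) * ln (real n) =
      (\<Sum>l<n * N. S_summand (real n / real m) (Suc l))) sequentially"
    using eventually_gt_at_top[of 0] by eventually_elim (simp only: eq)
  ultimately have "(\<lambda>N. \<Sum>l<n * N. S_summand (real n / real m) (Suc l)) \<longlonglongrightarrow>
      ln (2 * pi) / 2 - real n / (2 * real m) * euler_mascheroni
      - (\<Sum>r = 1..n. \<Sum>j<m. - 1/2) / real m + SF / real m
      + ln (real n) / 2 - real n / (2 * real m) * ln (real n)"
    by (rule Lim_transform_eventually)
  from LIMSEQ_unique[OF lim this] show ?thesis
    using m by (simp add: SF_def F_def)
qed

text \<open>Convergence is asserted separately because \<open>suminf\<close> is total, so an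
  equation for \<open>S\<close> alone would not express it.\<close>

theorem mainTheorem6:
  fixes m n :: nat
  assumes "m > 0" and "n > 0" and "coprime m n"
  shows "summable (\<lambda>l. S_summand (real n / real m) (Suc l)) \<and>
    S (real n / real m) =
      (ln (2 * pi) - euler_mascheroni) / 2 - 1 / (2 * real m) - 1 / 2 * ln (real m / real n)
      + pi / (2 * real n) *
          (\<Sum>k = 1..n - 1. (real n / 2 - real k) * cot (real m * real k * pi / real n))
      + real n * pi / (2 * (real m)\<^sup>2) *
          (\<Sum>j = 1..m - 1. (real m / 2 - real j) * cot (real n * real j * pi / real m))"
proof
  have m: "m > 0" and n: "n > 0" and cop: "coprime m n" by fact+
  show "summable (\<lambda>l. S_summand (real n / real m) (Suc l))"
    using m n by (intro summable_S_summand) simp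
  define U where "U = (\<Sum>k = 1..n - 1. (real n / 2 - real k) * cot (real m * real k * pi / real n))"
  define V where "V = (\<Sum>j = 1..m - 1. (real m / 2 - real j) * cot (real n * real j * pi / real m))"
  have U: "(\<Sum>r = 1..n - 1. (1/2 - real r / real n) * cot (pi * (real m * (real r / real n)))) = U / real n"
    unfolding U_def sum_divide_distrib using n
    by (intro sum.cong refl) (simp add: field_simps)
  have V: "(\<Sum>j = 1..m - 1. (1/2 - real j / real m) * cot (pi * (real n * (real j / real m)))) = V / real m"
    unfolding V_def sum_divide_distrib using m
    by (intro sum.cong refl) (simp add: field_simps)
  have Y: "(\<Sum>r = 1..n. \<Sum>j<m. real r / real n + real j / real m) = (real m - real n) / 2 + real m * real n"
  proof -
    have "(\<Sum>r = 1..n. \<Sum>j<m. real r / real n + real j / real m) =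
        (\<Sum>r = 1..n. \<Sum>j<m. real r / real n + real j / real m - 1) + real m * real n"
      by (simp add: sum_subtractf)
    then show ?thesis by (simp only: sum_grid_minus_1[OF m n])
  qed
  \<comment> \<open>The contributions n/(2m) gamma and n/(2m) ln n of the grid sum cancel those of
    the harmonic sum; the rational constants collapse to -1/(2m).\<close>
  have "S (real n / real m) = (ln (2 * pi) - euler_mascheroni) / 2 - 1 / (2 * real m)
      - 1 / 2 * ln (real m / real n) + pi / (2 * real n) * U + real n * pi / (2 * (real m)\<^sup>2) * V"
    unfolding S_rational_eq_grid[OF m n] sum_subtractf sum_Digamma_grid[OF m n cop] U V Y
    using m n by (simp add: ln_div field_simps power2_eq_square)
  then show "S (real n / real m) =
      (ln (2 * pi) - euler_mascheroni) / 2 - 1 / (2 * real m) - 1 / 2 * ln (real m / real n)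
      + pi / (2 * real n) *
          (\<Sum>k = 1..n - 1. (real n / 2 - real k) * cot (real m * real k * pi / real n))
      + real n * pi / (2 * (real m)\<^sup>2) *
          (\<Sum>j = 1..m - 1. (real m / 2 - real j) * cot (real n * real j * pi / real m))"
    unfolding U_def V_def .
qed

end
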